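(* Let $n$ be an odd positive integer and $S=\{0,\dots,n-1\}$. For $q=1,2,3$ let $\alpha_{1q},\alpha_{2q},\alpha_{3q}\in\{1,\dots,n-1\}$ satisfy, for each $q$ (writing $\alpha_\ell=\alpha_{\ell q}$, $A=\alpha_1+\alpha_2+\alpha_3$): $\gcd(\alpha_\ell,n)=1$; $\gcd(\alpha_\ell\pm\alpha_{\ell'},n)=1$ for $\ell\ne\ell'$; $\gcd(A,n)=1$; $\gcd(A-2\alpha_\ell,n)=1$; and suppose $\gcd(\det(\alpha_{pq})_{p,q=1}^3,n)=1$. Let $C^{(q)}_{ijk}\equiv\alpha_{1q}i+\alpha_{2q}j+\alpha_{3q}k\pmod n$ with entries in $S$ (three orthogonal pandiagonal latin cubes), and define $M^{(3)}=n^2C^{(1)}+nC^{(2)}+C^{(3)}$ entrywise. Then $M^{(3)}$ is a magic pandiagonal cube.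
   Context: For an $n\times n$ array indexed by $(x,y)\in S^2$, its ROWS are, for each $c\in S$, the index sets $\{(x,c)\}_x$, $\{(c,y)\}_y$, $\{(x,x+c\bmod n)\}_x$, $\{(x,c-x\bmod n)\}_x$. The $3n+6$ constituent squares of an $n\times n\times n$ array $(M_{ijk})$ are the $3n$ squares obtained by fixing one of $i,j,k$, and the six squares $(M_{iik})_{i,k}$, $(M_{i,n-1-i,k})_{i,k}$, $(M_{iji})_{i,j}$, $(M_{i,j,n-1-i})_{i,j}$, $(M_{ijj})_{i,j}$, $(M_{i,j,n-1-j})_{i,j}$. An $n\times n\times n$ array $M$ is a magic pandiagonal cube if its entries are exactly the integers $0,1,\dots,n^3-1$, each occurring once, and the sum of the entries along every ROW of every constituent square equals $n(n^3-1)/2$. *)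

theory Defs
  imports "HOL-Analysis.Determinants"
begin

text \<open>
  An \<open>n \<times> n\<close> (resp. \<open>n \<times> n \<times> n\<close>) array is a function of two (resp. three) integer arguments,
  of which only the values at arguments in \<open>S = {0..<n}\<close> are relevant.
\<close>

definition rows :: "int \<Rightarrow> (int \<times> int) set set" where
  "rows n = (\<Union>c\<in>{0..<n}.
     {(\<lambda>x. (x, c)) ` {0..<n},
      (\<lambda>y. (c, y)) ` {0..<n},
      (\<lambda>x. (x, (x + c) mod n)) ` {0..<n},
      (\<lambda>x. (x, (c - x) mod n)) ` {0..<n}})"

definition constituent_squares ::
    "int \<Rightarrow> (int \<Rightarrow> int \<Rightarrow> int \<Rightarrow> int) \<Rightarrow> (int \<Rightarrow> int \<Rightarrow> int) set" where
  "constituent_squares n M =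
     (\<lambda>i. (\<lambda>j k. M i j k)) ` {0..<n} \<union>
     (\<lambda>j. (\<lambda>i k. M i j k)) ` {0..<n} \<union>
     (\<lambda>k. (\<lambda>i j. M i j k)) ` {0..<n} \<union>
     {(\<lambda>i k. M i i k),
      (\<lambda>i k. M i (n - 1 - i) k),
      (\<lambda>i j. M i j i),
      (\<lambda>i j. M i j (n - 1 - i)),
      (\<lambda>i j. M i j j),
      (\<lambda>i j. M i j (n - 1 - j))}"

text \<open>The division by 2 is exact, since \<open>n * (n ^ 3 - 1)\<close> is always even.\<close>

definition magic_pandiagonal_cube :: "int \<Rightarrow> (int \<Rightarrow> int \<Rightarrow> int \<Rightarrow> int) \<Rightarrow> bool" where
  "magic_pandiagonal_cube n M \<longleftrightarrow>
     bij_betw (\<lambda>(i, j, k). M i j k) ({0..<n} \<times> {0..<n} \<times> {0..<n}) {0..<n ^ 3} \<and>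
     (\<forall>Q \<in> constituent_squares n M. \<forall>R \<in> rows n.
        (\<Sum>(x, y)\<in>R. Q x y) = n * (n ^ 3 - 1) div 2)"

text \<open>The coefficient \<open>\<alpha>\<^sub>p\<^sub>q\<close> is \<open>\<alpha> $ p $ q\<close>, so column \<open>q\<close> of the matrix gives the cube \<open>C\<^sup>(\<^sup>q\<^sup>)\<close>.\<close>

definition linear_cube :: "int \<Rightarrow> int ^ 3 ^ 3 \<Rightarrow> 3 \<Rightarrow> int \<Rightarrow> int \<Rightarrow> int \<Rightarrow> int" where
  "linear_cube n \<alpha> q i j k = (\<alpha> $ 1 $ q * i + \<alpha> $ 2 $ q * j + \<alpha> $ 3 $ q * k) mod n"

end

theory Submission
  imports Defs
begin

text \<open>
  Along every ROW of a constituent square, each of the three latin cubes reads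
  \<open>x \<mapsto> (a * x + b) mod n\<close> with \<open>a\<close> one of the numbers assumed coprime to \<open>n\<close> (up to sign), so it
  runs through \<open>0, \<dots>, n - 1\<close>. The sum along a ROW is thus
  \<open>(n\<^sup>2 + n + 1) * (n * (n - 1) / 2) = n * (n\<^sup>3 - 1) / 2\<close>.
  The entries of the cube have the three latin entries as base \<open>n\<close> digits, and by Cramer's rule
  these determine \<open>(i, j, k)\<close> modulo \<open>n\<close>, because the determinant is invertible modulo \<open>n\<close>.
\<close>

lemma inj_on_affine_mod:
  fixes a b n :: int
  assumes "coprime a n"
  shows "inj_on (\<lambda>x. (a * x + b) mod n) {0..<n}"
proof (rule inj_onI)
  fix x y assume xy: "x \<in> {0..<n}" "y \<in> {0..<n}" and "(a * x + b) mod n = (a * y + b) mod n"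
  then have "n dvd a * (x - y)"
    by (simp add: mod_eq_dvd_iff algebra_simps)
  then have "n dvd x - y"
    using assms by (simp add: coprime_commute coprime_dvd_mult_right_iff)
  then have "x mod n = y mod n"
    by (simp add: mod_eq_dvd_iff)
  then show "x = y"
    using xy by simp
qed

lemma sum_affine_mod:
  fixes a b n :: int
  assumes "coprime a n"
  shows "(\<Sum>x\<in>{0..<n}. (a * x + b) mod n) = \<Sum>{0..<n}"
proof -
  have "(\<lambda>x. (a * x + b) mod n) ` {0..<n} \<subseteq> {0..<n}"
    by auto
  then have "(\<lambda>x. (a * x + b) mod n) ` {0..<n} = {0..<n}"
    using inj_on_affine_mod[OF assms] by (simp add: endo_inj_surj)
  then show ?thesis
    using sum.reindex[OF inj_on_affine_mod[OF assms, of b], of "\<lambda>x. x"] by simp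
qed

text \<open>Doubling keeps the formula free of \<open>div\<close>. The induction needs natural
  numbers, so the integer interval is first reindexed along \<open>int\<close>.\<close>

lemma twice_sum_atLeast0LessThan_int:
  fixes n :: int
  assumes "n > 0"
  shows "2 * \<Sum>{0..<n} = n * (n - 1)"
proof -
  have "\<Sum>{0..<int m} = (\<Sum>i<m. int i)" for m
    using sum.reindex[of int "{0..<m}" "\<lambda>x. x"]
    by (simp add: image_int_atLeastLessThan flip: atLeast0LessThan)
  moreover have "2 * (\<Sum>i<m. int i) = int m * (int m - 1)" for m
    by (induction m) (simp_all add: algebra_simps)
  ultimately show ?thesis
    using assms by (metis zero_less_imp_eq_int)
qed

text \<open>One condition for each family of ROWS: a step along them is (1,0), (0,1), (1,1) or
  (1,-1) modulo \<open>n\<close>, and changes \<open>a * x + b * y\<close> by \<open>a\<close>,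
  \<open>b\<close>, \<open>a + b\<close> or \<open>a - b\<close>.\<close>

definition pandiagonal_coeffs :: "int \<Rightarrow> int \<Rightarrow> int \<Rightarrow> bool" where
  "pandiagonal_coeffs n a b \<longleftrightarrow>
     coprime a n \<and> coprime b n \<and> coprime (a + b) n \<and> coprime (a - b) n"

lemma sum_affine_square_row:
  assumes "pandiagonal_coeffs n a b" and "R \<in> rows n"
  shows "(\<Sum>(x, y)\<in>R. (a * x + b * y + c) mod n) = \<Sum>{0..<n}"
proof -
  have cop: "coprime a n" "coprime b n" "coprime (a + b) n" "coprime (a - b) n"
    using assms(1) by (auto simp: pandiagonal_coeffs_def)
  \<comment> \<open>The wrap-around of a broken diagonal is absorbed by the outer
    \<open>mod n\<close>, leaving an affine function of \<open>x\<close>.\<close>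
  have up: "(a * x + b * ((x + d) mod n) + c) mod n = ((a + b) * x + (b * d + c)) mod n" for x d
  proof -
    have "(a * x + b * ((x + d) mod n) + c) mod n = (a * x + b * (x + d) + c) mod n"
      by (intro mod_add_cong mod_mult_cong) simp_all
    then show ?thesis
      by (simp add: algebra_simps)
  qed
  have down: "(a * x + b * ((d - x) mod n) + c) mod n = ((a - b) * x + (b * d + c)) mod n" for x d
  proof -
    have "(a * x + b * ((d - x) mod n) + c) mod n = (a * x + b * (d - x) + c) mod n"
      by (intro mod_add_cong mod_mult_cong) simp_all
    then show ?thesis
      by (simp add: algebra_simps)
  qed
  have "(\<Sum>x\<in>{0..<n}. (a * x + b * d + c) mod n) = \<Sum>{0..<n}" for d
    using sum_affine_mod[OF cop(1), of "b * d + c"] by (simp add: add.assoc)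
  moreover have "(\<Sum>y\<in>{0..<n}. (a * d + b * y + c) mod n) = \<Sum>{0..<n}" for d
    using sum_affine_mod[OF cop(2), of "a * d + c"] by (simp add: ac_simps)
  ultimately show ?thesis
    using assms(2)
    by (auto simp: rows_def sum.reindex inj_on_def up down sum_affine_mod[OF cop(3)]
        sum_affine_mod[OF cop(4)])
qed

text \<open>Serves every kind of constituent square: \<open>a q\<close> and \<open>b q\<close> are
  the coefficients of the two coordinates left in the \<open>q\<close>-th latin cube, and
  \<open>c q\<close> collects the constant terms.\<close>

lemma sum_composite_square_row:
  fixes n :: int and a b c :: "3 \<Rightarrow> int"
  assumes "n > 0" and "R \<in> rows n"
    and "\<And>q. pandiagonal_coeffs n (a q) (b q)"
    and Q: "\<And>x y. Q x y = n ^ 2 * ((a 1 * x + b 1 * y + c 1) mod n)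
               + n * ((a 2 * x + b 2 * y + c 2) mod n) + (a 3 * x + b 3 * y + c 3) mod n"
  shows "(\<Sum>(x, y)\<in>R. Q x y) = n * (n ^ 3 - 1) div 2"
proof -
  define L where "L q = (\<lambda>(x, y). (a q * x + b q * y + c q) mod n)" for q
  have L: "sum (L q) R = \<Sum>{0..<n}" for q
    unfolding L_def using assms by (intro sum_affine_square_row)
  have "(\<Sum>(x, y)\<in>R. Q x y) = (\<Sum>p\<in>R. n ^ 2 * L 1 p + n * L 2 p + L 3 p)"
    by (intro sum.cong) (auto simp: L_def Q)
  also have "\<dots> = (n ^ 2 + n + 1) * \<Sum>{0..<n}"
    by (simp add: sum.distrib L flip: sum_distrib_left) (simp add: algebra_simps)
  \<comment> \<open>An equation for twice the sum makes the final \<open>div 2\<close> exact without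
    a parity argument.\<close>
  finally have "2 * (\<Sum>(x, y)\<in>R. Q x y) = (n ^ 2 + n + 1) * (n * (n - 1))"
    by (simp flip: twice_sum_atLeast0LessThan_int[OF \<open>n > 0\<close>])
  also have "\<dots> = n * (n ^ 3 - 1)"
    by (simp add: algebra_simps power2_eq_square power3_eq_cube)
  finally show ?thesis
    by simp
qed

lemma base_digits_unique:
  fixes n :: int
  assumes "a \<in> {0..<n}" "a' \<in> {0..<n}" "n * u + a = n * u' + a'"
  shows "u = u'" "a = a'"
proof -
  show "a = a'"
    using arg_cong[OF assms(3), of "\<lambda>x. x mod n"] assms(1,2) by simp
  \<comment> \<open>Cancelling \<open>n\<close> is allowed: a digit in \<open>{0..<n}\<close> forces
    \<open>n > 0\<close>.\<close>
  then show "u = u'"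
    using assms by auto
qed

lemma linear_cubes_determine_index:
  assumes det: "coprime (det \<alpha>) n"
    and S: "i \<in> {0..<n}" "j \<in> {0..<n}" "k \<in> {0..<n}" "i' \<in> {0..<n}" "j' \<in> {0..<n}" "k' \<in> {0..<n}"
    and eq: "\<And>q. linear_cube n \<alpha> q i j k = linear_cube n \<alpha> q i' j' k'"
  shows "i = i' \<and> j = j' \<and> k = k'"
proof -
  define f where "f q = \<alpha> $ 1 $ q * (i - i') + \<alpha> $ 2 $ q * (j - j') + \<alpha> $ 3 $ q * (k - k')" for q
  have f: "n dvd f q" for q
    using eq[of q] by (simp add: linear_cube_def mod_eq_dvd_iff f_def algebra_simps)
  let ?m = "\<lambda>p q. \<alpha> $ p $ q"
  \<comment> \<open>The multipliers of \<open>f q\<close> are the cofactors of row 1 of \<alpha>.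
    Summing over \<open>q\<close>, row 1 yields the determinant and the other rows cancel. The next
    two identities use the cofactors of rows 2 and 3.\<close>
  have "det \<alpha> * (i - i') = (?m 2 2 * ?m 3 3 - ?m 2 3 * ?m 3 2) * f 1
      + (?m 2 3 * ?m 3 1 - ?m 2 1 * ?m 3 3) * f 2 + (?m 2 1 * ?m 3 2 - ?m 2 2 * ?m 3 1) * f 3"
    unfolding det_3 f_def by algebra
  moreover have "det \<alpha> * (j - j') = (?m 1 3 * ?m 3 2 - ?m 1 2 * ?m 3 3) * f 1
      + (?m 1 1 * ?m 3 3 - ?m 1 3 * ?m 3 1) * f 2 + (?m 1 2 * ?m 3 1 - ?m 1 1 * ?m 3 2) * f 3"
    unfolding det_3 f_def by algebra
  moreover have "det \<alpha> * (k - k') = (?m 1 2 * ?m 2 3 - ?m 1 3 * ?m 2 2) * f 1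
      + (?m 1 3 * ?m 2 1 - ?m 1 1 * ?m 2 3) * f 2 + (?m 1 1 * ?m 2 2 - ?m 1 2 * ?m 2 1) * f 3"
    unfolding det_3 f_def by algebra
  ultimately have "n dvd det \<alpha> * (i - i')" "n dvd det \<alpha> * (j - j')" "n dvd det \<alpha> * (k - k')"
    using f by simp_all
  then have "n dvd i - i'" "n dvd j - j'" "n dvd k - k'"
    using det by (simp_all add: coprime_commute coprime_dvd_mult_right_iff)
  then have "i mod n = i' mod n" "j mod n = j' mod n" "k mod n = k' mod n"
    by (simp_all add: mod_eq_dvd_iff)
  then show ?thesis
    using S by simp
qed

lemma bij_betw_composite_cube:
  assumes "n > 0" and det: "coprime (det \<alpha>) n"
  shows "bij_betw (\<lambda>(i, j, k). n ^ 2 * linear_cube n \<alpha> 1 i j k + n * linear_cube n \<alpha> 2 i j k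
            + linear_cube n \<alpha> 3 i j k) ({0..<n} \<times> {0..<n} \<times> {0..<n}) {0..<n ^ 3}"
    (is "bij_betw ?f ?S ?T")
proof -
  have digit: "linear_cube n \<alpha> q i j k \<in> {0..<n}" for q i j k
    using \<open>n > 0\<close> by (simp add: linear_cube_def)
  \<comment> \<open>Horner form lets \<open>base_digits_unique\<close> and \<open>bound\<close>
    treat one digit at a time.\<close>
  have horner: "n ^ 2 * a + n * b + c = n * (n * a + b) + c" for a b c
    by (simp add: power2_eq_square algebra_simps)
  have inj: "inj_on ?f ?S"
  proof (rule inj_onI)
    fix p p' assume pS: "p \<in> ?S" "p' \<in> ?S" and eq: "?f p = ?f p'"
    obtain i j k i' j' k' where p: "p = (i, j, k)" "p' = (i', j', k')"
      by (metis prod_cases3)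
    \<comment> \<open>This splits off the digit of cube 3; a second application to
      \<open>digits(1)\<close> separates cubes 1 and 2.\<close>
    note digits = base_digits_unique[OF digit digit eq[unfolded p prod.case horner]]
    have "linear_cube n \<alpha> q i j k = linear_cube n \<alpha> q i' j' k'" for q
      using digits(2) base_digits_unique[OF digit digit digits(1)] exhaust_3[of q] by auto
    then have "i = i' \<and> j = j' \<and> k = k'"
      using pS unfolding p by (intro linear_cubes_determine_index[OF det]) simp_all
    then show "p = p'"
      by (simp add: p)
  qed
  have bound: "n * u + a \<in> {0..<n * m}" if "u \<in> {0..<m}" "a \<in> {0..<n}" for u a m
  proof -
    have "n * (u + 1) \<le> n * m"
      using that \<open>n > 0\<close> by (intro mult_left_mono) auto
    then show ?thesis
      using that \<open>n > 0\<close> by (auto simp: algebra_simps)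
  qed
  have "n ^ 3 = n * (n * n)"
    by (simp add: power3_eq_cube)
  \<comment> \<open>\<open>bound\<close> is used with \<open>m = n\<close> for the two leading
    digits, then with \<open>m = n * n\<close>. Surjectivity follows by counting.\<close>
  then have "?f ` ?S \<subseteq> ?T"
    using bound[OF bound[OF digit digit] digit] unfolding horner by (auto simp del: atLeastLessThan_iff)
  moreover have "card (?f ` ?S) = card ?T"
    using \<open>n > 0\<close> by (simp add: card_image[OF inj] card_cartesian_product power3_eq_cube nat_mult_distrib)
  ultimately have "?f ` ?S = ?T"
    by (intro card_subset_eq) simp_all
  with inj show ?thesis
    by (simp add: bij_betw_def)
qed

theorem mainTheorem9:
  fixes n :: int and \<alpha> :: "int ^ 3 ^ 3" and A :: "3 \<Rightarrow> int"
  assumes "n > 0" and "odd n"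
    and "\<And>q. A q = \<alpha> $ 1 $ q + \<alpha> $ 2 $ q + \<alpha> $ 3 $ q"
    and "\<And>l q. \<alpha> $ l $ q \<in> {1..n - 1}"
    and "\<And>l q. gcd (\<alpha> $ l $ q) n = 1"
    and "\<And>l l' q. l \<noteq> l' \<Longrightarrow> gcd (\<alpha> $ l $ q + \<alpha> $ l' $ q) n = 1"
    and "\<And>l l' q. l \<noteq> l' \<Longrightarrow> gcd (\<alpha> $ l $ q - \<alpha> $ l' $ q) n = 1"
    and "\<And>q. gcd (A q) n = 1"
    and "\<And>l q. gcd (A q - 2 * \<alpha> $ l $ q) n = 1"
    and "gcd (det \<alpha>) n = 1"
  shows "magic_pandiagonal_cube n
           (\<lambda>i j k. n ^ 2 * linear_cube n \<alpha> 1 i j k + n * linear_cube n \<alpha> 2 i j k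
                    + linear_cube n \<alpha> 3 i j k)"
proof -
  let ?M = "\<lambda>i j k. n ^ 2 * linear_cube n \<alpha> 1 i j k + n * linear_cube n \<alpha> 2 i j k
              + linear_cube n \<alpha> 3 i j k"
  have single: "coprime (\<alpha> $ l $ q) n" for l q
    using assms(5) by (simp add: coprime_iff_gcd_eq_1)
  have plus: "coprime (\<alpha> $ l $ q + \<alpha> $ l' $ q) n" if "l \<noteq> l'" for l l' q
    using assms(6) that by (simp add: coprime_iff_gcd_eq_1)
  have minus: "coprime (\<alpha> $ l $ q - \<alpha> $ l' $ q) n" if "l \<noteq> l'" for l l' q
    using assms(7) that by (simp add: coprime_iff_gcd_eq_1)
  have ppp: "coprime (\<alpha> $ 1 $ q + \<alpha> $ 2 $ q + \<alpha> $ 3 $ q) n" for q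
    using assms(3,8) by (simp add: coprime_iff_gcd_eq_1)
  \<comment> \<open>Subtracting \<open>2 * \<alpha> $ l $ q\<close> from \<open>A q\<close> flips
    the sign of the \<open>l\<close>-th term. For \<open>l = 1\<close> the negated version is needed
    to make the coefficient of \<alpha> $ 1 positive, as in \<open>pmm\<close>.\<close>
  have signed: "coprime (A q - 2 * \<alpha> $ l $ q) n" "coprime (- (A q - 2 * \<alpha> $ l $ q)) n" for l q
    using assms(9) by (simp_all only: coprime_iff_gcd_eq_1 gcd_neg1_int)
  have ppm: "coprime (\<alpha> $ 1 $ q + \<alpha> $ 2 $ q - \<alpha> $ 3 $ q) n" for q
    using signed(1)[of q 3] by (simp add: assms(3) algebra_simps)
  have pmp: "coprime (\<alpha> $ 1 $ q - \<alpha> $ 2 $ q + \<alpha> $ 3 $ q) n" for q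
    using signed(1)[of q 2] by (simp add: assms(3) algebra_simps)
  have pmm: "coprime (\<alpha> $ 1 $ q - \<alpha> $ 2 $ q - \<alpha> $ 3 $ q) n" for q
    using signed(2)[of q 1] by (simp add: assms(3) algebra_simps)
  note cop = single plus minus ppp ppm pmp pmm
  have square: "(\<Sum>(x, y)\<in>R. Q x y) = n * (n ^ 3 - 1) div 2"
    if R: "R \<in> rows n" and Q: "Q \<in> constituent_squares n ?M" for R Q
  proof -
    note row = sum_composite_square_row[OF \<open>n > 0\<close> R]
    consider
        (i) i where "Q = (\<lambda>j k. ?M i j k)" | (j) j where "Q = (\<lambda>i k. ?M i j k)"
      | (k) k where "Q = (\<lambda>i j. ?M i j k)"
      | (ij) "Q = (\<lambda>i k. ?M i i k)" | (ij') "Q = (\<lambda>i k. ?M i (n - 1 - i) k)"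
      | (ik) "Q = (\<lambda>i j. ?M i j i)" | (ik') "Q = (\<lambda>i j. ?M i j (n - 1 - i))"
      | (jk) "Q = (\<lambda>i j. ?M i j j)" | (jk') "Q = (\<lambda>i j. ?M i j (n - 1 - j))"
      using Q unfolding constituent_squares_def by blast
    then show ?thesis
    proof cases
      case i
      show ?thesis
        by (rule row[where a = "\<lambda>q. \<alpha> $ 2 $ q" and b = "\<lambda>q. \<alpha> $ 3 $ q" and c = "\<lambda>q. \<alpha> $ 1 $ q * i"])
          (simp_all add: i pandiagonal_coeffs_def cop linear_cube_def algebra_simps)
    next
      case j
      show ?thesis
        by (rule row[where a = "\<lambda>q. \<alpha> $ 1 $ q" and b = "\<lambda>q. \<alpha> $ 3 $ q" and c = "\<lambda>q. \<alpha> $ 2 $ q * j"])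
          (simp_all add: j pandiagonal_coeffs_def cop linear_cube_def algebra_simps)
    next
      case k
      show ?thesis
        by (rule row[where a = "\<lambda>q. \<alpha> $ 1 $ q" and b = "\<lambda>q. \<alpha> $ 2 $ q" and c = "\<lambda>q. \<alpha> $ 3 $ q * k"])
          (simp_all add: k pandiagonal_coeffs_def cop linear_cube_def algebra_simps)
    next
      \<comment> \<open>On a diagonal square two coefficients merge into one, so the sum and
        difference with the remaining one are combinations of all three: here \<open>ppp\<close> and
        \<open>ppm\<close>.\<close>
      case ij
      show ?thesis
        by (rule row[where a = "\<lambda>q. \<alpha> $ 1 $ q + \<alpha> $ 2 $ q" and b = "\<lambda>q. \<alpha> $ 3 $ q" and c = "\<lambda>q. 0"])
          (simp_all add: ij pandiagonal_coeffs_def cop linear_cube_def ring_distribs)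
    next
      \<comment> \<open>Replacing \<open>j\<close> by \<open>n - 1 - i\<close> turns the coefficient
        of \<open>i\<close> into a difference and leaves the constant
        \<open>\<alpha> $ 2 $ q * (n - 1)\<close>; \<open>ik'\<close> and \<open>jk'\<close> are
        analogous.\<close>
      case ij'
      show ?thesis
        by (rule row[where a = "\<lambda>q. \<alpha> $ 1 $ q - \<alpha> $ 2 $ q" and b = "\<lambda>q. \<alpha> $ 3 $ q"
              and c = "\<lambda>q. \<alpha> $ 2 $ q * (n - 1)"])
          (simp add: pandiagonal_coeffs_def cop, simp add: ij' linear_cube_def algebra_simps)
    next
      case ik
      show ?thesis
        by (rule row[where a = "\<lambda>q. \<alpha> $ 1 $ q + \<alpha> $ 3 $ q" and b = "\<lambda>q. \<alpha> $ 2 $ q" and c = "\<lambda>q. 0"])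
          (use cop in \<open>simp add: pandiagonal_coeffs_def algebra_simps\<close>,
            simp add: ik linear_cube_def algebra_simps)
    next
      case ik'
      show ?thesis
        by (rule row[where a = "\<lambda>q. \<alpha> $ 1 $ q - \<alpha> $ 3 $ q" and b = "\<lambda>q. \<alpha> $ 2 $ q"
              and c = "\<lambda>q. \<alpha> $ 3 $ q * (n - 1)"])
          (use cop in \<open>simp add: pandiagonal_coeffs_def algebra_simps\<close>,
            simp add: ik' linear_cube_def algebra_simps)
    next
      case jk
      show ?thesis
        by (rule row[where a = "\<lambda>q. \<alpha> $ 1 $ q" and b = "\<lambda>q. \<alpha> $ 2 $ q + \<alpha> $ 3 $ q" and c = "\<lambda>q. 0"])
          (use cop in \<open>simp add: pandiagonal_coeffs_def algebra_simps\<close>,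
            simp add: jk linear_cube_def algebra_simps)
    next
      case jk'
      show ?thesis
        by (rule row[where a = "\<lambda>q. \<alpha> $ 1 $ q" and b = "\<lambda>q. \<alpha> $ 2 $ q - \<alpha> $ 3 $ q"
              and c = "\<lambda>q. \<alpha> $ 3 $ q * (n - 1)"])
          (use cop in \<open>simp add: pandiagonal_coeffs_def algebra_simps\<close>,
            simp add: jk' linear_cube_def algebra_simps)
    qed
  qed
  have "coprime (det \<alpha>) n"
    using assms(10) by (simp add: coprime_iff_gcd_eq_1)
  then show ?thesis
    unfolding magic_pandiagonal_cube_def using bij_betw_composite_cube[OF \<open>n > 0\<close>] square by blast
qed

end
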